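(* Suppose that for every $t\in\mathbb T$ the map $J(\cdot;t)$ is lower semi-continuous in the right side, in the sense that $\lim_{n\to\infty}J(\tau_n;t)\le J(\tau;t)$ for any decreasing sequence of stopping times $\tau_n\downarrow\tau$ in $\mathcal T(t)$. Suppose further that for any integer $n\ge1$ and any $t<\rho^{(n)}$ there exists $\tilde\rho\in\mathcal T(t)$ with $\rho^{(n)}\le\tilde\rho\le\rho^{(n-1)}$ such that $J(\tilde\rho;t)\ge J(t;t)$; that is, for every $n\ge1$ and $t\in\mathbb T$ there is $\tilde\rho\in\mathcal T(t)$ with $\rho^{(n)}\vee t\le\tilde\rho\le\rho^{(n-1)}\vee t$ and $J(\tilde\rho;t)\ge J(t;t)$ on the event $\{t<\rho^{(n)}\}$. Then $\rho^{(\infty)}=\lim_{n\to\infty}\rho^{(n)}$ is approachable.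
   Context: Setting. $(\Omega,\mathcal F,\mathbb P)$ is a probability space, $\mathbb T\subset[0,\infty)$ is a general set of time points (discrete, continuous or hybrid) with $0\in\mathbb T$, $T=\sup\mathbb T\in[0,+\infty]$, and $\{\mathcal F_t\}_{t\in\mathbb T}$ is a right-continuous filtration. For a stopping time $\rho$, $\mathcal T(\rho)$ is the set of stopping times $\tau\ge\rho$; thus $\mathcal T(0)$ is the set of all stopping times, and the constant $T$ belongs to it. Stopping times that are a.s. equal are identified and inequalities between them are understood a.s. For every $t\in\mathbb T$ a preference is given: a map $J(\cdot;t):\mathcal T(t)\to L^0(\Omega,\mathcal F_t,\mathbb R)$ (so $J(\tau;t)$ is $\mathcal F_t$-measurable) such that $J(\tau_1;t)=J(\tau_2;t)$ if $\tau_1=\tau_2$ a.s. The map $F$. For $\rho\in\mathcal T(0)$, $F(\rho)=\inf\{t<\rho:\ J(t;t)>J(\tau;t)\ \text{for all stopping times }\tau\text{ with }t<\tau\le\rho\}\wedge\rho$, read $\omega$ by $\omega$: a time $t\in\mathbb T$ with $t<\rho(\omega)$ is in the set iff $J(t;t)(\omega)>J(\tau;t)(\omega)$ for every $\tau\in\mathcal T(t)$ with $\tau\le\rho\vee t$ and $\tau(\omega)>t$. With the filtration right continuous, $F(\rho)$ is a stopping time, so $F:\mathcal T(0)\to\mathcal T(0)$. A stopping time $\tau$ is approachable if $F(\tau)=\tau$. The $n$-th order naive times are $\rho^{(0)}=T$ and $\rho^{(n)}=F(\rho^{(n-1)})$ for $n\ge1$; they are decreasing in $n$, and $\rho^{(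\infty)}:=\lim_{n\to+\infty}\rho^{(n)}$.
   Formalization: The two hypotheses' inequalities between values of J are taken to hold almost surely simultaneously for all t (one null set per choice of stopping times); with null sets depending on t the claim fails for uncountable time sets, since F is read ω by ω. For countable time sets nothing changes. *)

theory Defs
  imports "HOL-Probability.Probability"
begin

text \<open>
  \<open>TT\<close> is the set of time points and \<open>F t\<close>, for \<open>t \<in> TT\<close>, the \<open>\<sigma>\<close>-algebra at time \<open>t\<close>;
  \<open>F\<close> is irrelevant off \<open>TT\<close>. Random times take values in \<open>ereal\<close>, since the horizon may
  be \<open>\<infinity>\<close>.
\<close>

definition horizon :: "real set \<Rightarrow> ereal" where
  "horizon TT = Sup (ereal ` TT)"

text \<open>
  The values a stopping time may take. Infima of sets of time points are admitted so that
  \<open>naive_map\<close> and decreasing limits do not leave the class when \<open>TT\<close> is not closed from the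
  right. If it is (\<open>{0..N}\<close>, \<open>[0, a]\<close>, \<open>[0, \<infinity>)\<close>, ...), this set is just \<open>TT\<close> together with the
  horizon.
\<close>

definition time_values :: "real set \<Rightarrow> ereal set" where
  "time_values TT = insert (horizon TT) {Inf (ereal ` S) | S. S \<subseteq> TT \<and> S \<noteq> {}}"

definition is_stopping_time ::
    "'a measure \<Rightarrow> real set \<Rightarrow> (real \<Rightarrow> 'a measure) \<Rightarrow> ('a \<Rightarrow> ereal) \<Rightarrow> bool" where
  "is_stopping_time M TT F \<tau> \<longleftrightarrow>
     (\<forall>\<omega>\<in>space M. \<tau> \<omega> \<in> time_values TT) \<and>
     (\<forall>t\<in>TT. Measurable.pred (F t) (\<lambda>\<omega>. \<tau> \<omega> \<le> ereal t))"

definition stopping_times_from ::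
    "'a measure \<Rightarrow> real set \<Rightarrow> (real \<Rightarrow> 'a measure) \<Rightarrow> ('a \<Rightarrow> ereal) \<Rightarrow> ('a \<Rightarrow> ereal) set" where
  "stopping_times_from M TT F \<rho> =
     {\<tau>. is_stopping_time M TT F \<tau> \<and> (AE \<omega> in M. \<rho> \<omega> \<le> \<tau> \<omega>)}"

abbreviation const_time :: "real \<Rightarrow> 'a \<Rightarrow> ereal" where
  "const_time t \<equiv> (\<lambda>_. ereal t)"

text \<open>
  Right continuity is required at those \<open>t \<in> TT\<close> that are limits of later time points; at
  the other points it is void (discrete time). The preference \<open>J(\<tau>; t)(\<omega>)\<close> is written
  \<open>J \<tau> t \<omega>\<close>. The assumption \<open>J_restrict\<close> only says that the values of \<open>\<tau>\<close> off \<open>space M\<close> are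
  meaningless.
\<close>

locale preference_setting = prob_space M
  for M :: "'a measure" +
  fixes TT :: "real set"
    and F :: "real \<Rightarrow> 'a measure"
    and J :: "('a \<Rightarrow> ereal) \<Rightarrow> real \<Rightarrow> 'a \<Rightarrow> real"
  assumes times_nonneg: "TT \<subseteq> {0..}"
    and zero_time: "0 \<in> TT"
    and filtration_sub: "\<And>t. t \<in> TT \<Longrightarrow> subalgebra M (F t)"
    and filtration_mono: "\<And>s t. s \<in> TT \<Longrightarrow> t \<in> TT \<Longrightarrow> s \<le> t \<Longrightarrow> sets (F s) \<subseteq> sets (F t)"
    and right_continuous: "\<And>t. t \<in> TT \<Longrightarrow> t islimpt (TT \<inter> {t<..}) \<Longrightarrow>
          sets (F t) = (\<Inter>s\<in>TT \<inter> {t<..}. sets (F s))"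
    and J_measurable: "\<And>t \<tau>. t \<in> TT \<Longrightarrow> \<tau> \<in> stopping_times_from M TT F (const_time t) \<Longrightarrow>
          J \<tau> t \<in> borel_measurable (F t)"
    and J_cong: "\<And>t \<tau>1 \<tau>2. t \<in> TT \<Longrightarrow>
          \<tau>1 \<in> stopping_times_from M TT F (const_time t) \<Longrightarrow>
          \<tau>2 \<in> stopping_times_from M TT F (const_time t) \<Longrightarrow>
          (AE \<omega> in M. \<tau>1 \<omega> = \<tau>2 \<omega>) \<Longrightarrow> (AE \<omega> in M. J \<tau>1 t \<omega> = J \<tau>2 t \<omega>)"
    and J_restrict: "\<And>t \<tau>1 \<tau>2 \<omega>. t \<in> TT \<Longrightarrow>
          \<tau>1 \<in> stopping_times_from M TT F (const_time t) \<Longrightarrow>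
          \<tau>2 \<in> stopping_times_from M TT F (const_time t) \<Longrightarrow>
          (\<forall>\<omega>'\<in>space M. \<tau>1 \<omega>' = \<tau>2 \<omega>') \<Longrightarrow> \<omega> \<in> space M \<Longrightarrow> J \<tau>1 t \<omega> = J \<tau>2 t \<omega>"

text \<open>
  Inequalities between random times are almost sure; the comparison of preferences and the
  condition \<open>t < \<tau>\<close> are read at the given \<open>\<omega>\<close>. The infimum of the empty set is \<open>\<infinity>\<close>.
  The map is defined for all random times \<open>\<rho>\<close>, so nothing about the measurability of its values
  has to be presupposed in order to iterate it.
\<close>

definition naive_map ::
    "'a measure \<Rightarrow> real set \<Rightarrow> (real \<Rightarrow> 'a measure) \<Rightarrow>
     (('a \<Rightarrow> ereal) \<Rightarrow> real \<Rightarrow> 'a \<Rightarrow> real) \<Rightarrow> ('a \<Rightarrow> ereal) \<Rightarrow> 'a \<Rightarrow> ereal" where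
  "naive_map M TT F J \<rho> \<omega> =
     min (Inf (ereal ` {t\<in>TT. ereal t < \<rho> \<omega> \<and>
            (\<forall>\<tau>\<in>stopping_times_from M TT F (const_time t).
               (AE \<omega>' in M. \<tau> \<omega>' \<le> max (\<rho> \<omega>') (ereal t)) \<and> ereal t < \<tau> \<omega> \<longrightarrow>
               J (const_time t) t \<omega> > J \<tau> t \<omega>)}))
         (\<rho> \<omega>)"

text \<open>
  Stopping times that agree almost surely are identified: a random time counts as a stopping
  time here as soon as it agrees almost surely with one.
\<close>

definition approachable ::
    "'a measure \<Rightarrow> real set \<Rightarrow> (real \<Rightarrow> 'a measure) \<Rightarrow>
     (('a \<Rightarrow> ereal) \<Rightarrow> real \<Rightarrow> 'a \<Rightarrow> real) \<Rightarrow> ('a \<Rightarrow> ereal) \<Rightarrow> bool" where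
  "approachable M TT F J \<tau> \<longleftrightarrow>
     (\<exists>\<sigma>\<in>stopping_times_from M TT F (const_time 0). AE \<omega> in M. \<tau> \<omega> = \<sigma> \<omega>) \<and>
     (AE \<omega> in M. naive_map M TT F J \<tau> \<omega> = \<tau> \<omega>)"

primrec naive_time ::
    "'a measure \<Rightarrow> real set \<Rightarrow> (real \<Rightarrow> 'a measure) \<Rightarrow>
     (('a \<Rightarrow> ereal) \<Rightarrow> real \<Rightarrow> 'a \<Rightarrow> real) \<Rightarrow> nat \<Rightarrow> 'a \<Rightarrow> ereal" where
  "naive_time M TT F J 0 = (\<lambda>_. horizon TT)"
| "naive_time M TT F J (Suc n) = naive_map M TT F J (naive_time M TT F J n)"

definition naive_limit ::
    "'a measure \<Rightarrow> real set \<Rightarrow> (real \<Rightarrow> 'a measure) \<Rightarrow>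
     (('a \<Rightarrow> ereal) \<Rightarrow> real \<Rightarrow> 'a \<Rightarrow> real) \<Rightarrow> 'a \<Rightarrow> ereal" where
  "naive_limit M TT F J \<omega> = lim (\<lambda>n. naive_time M TT F J n \<omega>)"

text \<open>
  Semi-continuity of all the maps \<open>J(\<cdot>; t)\<close> along decreasing sequences \<open>\<tau> t n \<down> \<sigma> t\<close>, one
  sequence for each \<open>t\<close>. The family over \<open>t\<close> is there only to let the exceptional null set
  depend on the chosen sequences but not on \<open>t\<close>. For countable \<open>TT\<close> this amounts to the almost
  sure inequality for each \<open>t\<close> and each sequence; for arbitrary \<open>TT\<close> it follows from the
  inequality for every \<open>t\<close>, sequence and \<open>\<omega>\<close>. As \<open>naive_map\<close> looks at all times for a given
  \<open>\<omega>\<close>, null sets varying with \<open>t\<close> would say nothing about it when \<open>TT\<close> is uncountable. The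
  limit, which need not exist a priori, is read as the upper limit.
\<close>

definition right_semicontinuous ::
    "'a measure \<Rightarrow> real set \<Rightarrow> (real \<Rightarrow> 'a measure) \<Rightarrow>
     (('a \<Rightarrow> ereal) \<Rightarrow> real \<Rightarrow> 'a \<Rightarrow> real) \<Rightarrow> bool" where
  "right_semicontinuous M TT F J \<longleftrightarrow>
     (\<forall>\<tau> \<sigma>.
        (\<forall>t\<in>TT. (\<forall>n. \<tau> t n \<in> stopping_times_from M TT F (const_time t)) \<and>
           \<sigma> t \<in> stopping_times_from M TT F (const_time t) \<and>
           (AE \<omega> in M. decseq (\<lambda>n. \<tau> t n \<omega>) \<and> (\<lambda>n. \<tau> t n \<omega>) \<longlonglongrightarrow> \<sigma> t \<omega>)) \<longrightarrow>
        (AE \<omega> in M. \<forall>t\<in>TT.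
           limsup (\<lambda>n::nat. ereal (J (\<tau> t n) t \<omega>)) \<le> ereal (J (\<sigma> t) t \<omega>)))"

text \<open>As above, the exceptional null set may depend on the chosen \<open>\<rho>' t\<close> but not on \<open>t\<close>.\<close>

definition worth_continuing ::
    "'a measure \<Rightarrow> real set \<Rightarrow> (real \<Rightarrow> 'a measure) \<Rightarrow>
     (('a \<Rightarrow> ereal) \<Rightarrow> real \<Rightarrow> 'a \<Rightarrow> real) \<Rightarrow> ('a \<Rightarrow> ereal) \<Rightarrow> ('a \<Rightarrow> ereal) \<Rightarrow> bool" where
  "worth_continuing M TT F J \<rho>lo \<rho>hi \<longleftrightarrow>
     (\<exists>\<rho>'. (\<forall>t\<in>TT. \<rho>' t \<in> stopping_times_from M TT F (const_time t) \<and>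
              (AE \<omega> in M. max (\<rho>lo \<omega>) (ereal t) \<le> \<rho>' t \<omega> \<and>
                          \<rho>' t \<omega> \<le> max (\<rho>hi \<omega>) (ereal t))) \<and>
           (AE \<omega> in M. \<forall>t\<in>TT. ereal t < \<rho>lo \<omega> \<longrightarrow>
              J (\<rho>' t) t \<omega> \<ge> J (const_time t) t \<omega>))"

end

theory Submission
  imports Defs
begin

text \<open>
  Write \<open>\<rho>\<^sup>n\<close> for the naive times and \<open>\<rho>\<close> for their limit; since \<open>naive_map\<close> never increases
  its argument, they decrease and \<open>\<rho>\<close> is their infimum. To be approachable, \<open>\<rho>\<close> must agree
  almost surely with a stopping time, and almost surely no \<open>t < \<rho>\<close> may be strictly better than
  every way to continue up to \<open>\<rho>\<close>.

  Nothing is known about how \<open>J\<close> depends on \<open>t\<close>, so the \<open>\<rho>\<^sup>n\<close>, infima over possibly uncountable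
  sets of times, need not be measurable. The hypothesis on continuation, read at \<open>t = 0\<close>,
  supplies what is missing: it squeezes a stopping time between \<open>\<rho>\<^sup>n\<^sup>+\<^sup>1\<close> and \<open>\<rho>\<^sup>n\<close> for each \<open>n\<close>.
  The infimum \<open>\<sigma>\<close> of these is almost surely \<open>\<rho>\<close>, and it is a stopping time because the
  filtration is right continuous (\<open>is_stopping_time_INF\<close>).

  For a general \<open>t\<close> the continuations \<open>r n t\<close> lie between \<open>\<rho>\<^sup>n\<^sup>+\<^sup>1 \<or> t\<close> and \<open>\<rho>\<^sup>n \<or> t\<close> (\<open>\<or>\<close> is the
  maximum), so they decrease to \<open>\<rho> \<or> t = \<sigma> \<or> t\<close> almost surely. At a time \<open>t < \<rho>\<close>, which is then
  below all \<open>\<rho>\<^sup>n\<close>, each of them is at least as good as stopping at \<open>t\<close>, and by semi-continuity so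
  is their limit \<open>\<sigma> \<or> t\<close>. Hence \<open>\<sigma> \<or> t\<close> keeps \<open>t\<close> out of the set whose infimum defines
  \<open>naive_map\<close> at \<open>\<rho>\<close>.

  The care needed concerns null sets, as uncountably many \<open>t\<close> compete at the same outcome. The
  limit for \<open>t\<close> is therefore built from the single stopping time \<open>\<sigma>\<close> rather than from the
  sequence that belongs to \<open>t\<close>: off the one null set where \<open>\<sigma> \<noteq> \<rho>\<close>, it exceeds \<open>t\<close> for all
  \<open>t < \<rho>\<close> at once.
\<close>

section \<open>Values of stopping times\<close>

lemma time_values_const: "t \<in> TT \<Longrightarrow> ereal t \<in> time_values TT"
  unfolding time_values_def by (auto intro!: exI[of _ "{t}"])

lemma time_values_le_horizon: "v \<in> time_values TT \<Longrightarrow> v \<le> horizon TT"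
  unfolding time_values_def horizon_def by (force intro: Inf_lower2 Sup_upper)

text \<open>
  An infimum of infima of sets of times is the infimum of their union; values equal to the
  horizon do not affect it unless there is no other.
\<close>

lemma time_values_Inf:
  assumes "A \<noteq> {}" and "A \<subseteq> time_values TT"
  shows "Inf A \<in> time_values TT"
proof (cases "A \<subseteq> {horizon TT}")
  case True
  then have "A = {horizon TT}" using assms(1) by blast
  then show ?thesis by (simp add: time_values_def)
next
  case False
  define B where "B = A - {horizon TT}"
  have "B \<noteq> {}" using False by (auto simp: B_def)
  have "\<forall>v\<in>B. \<exists>S. S \<subseteq> TT \<and> S \<noteq> {} \<and> v = Inf (ereal ` S)"
    using assms(2) by (auto simp: B_def time_values_def)
  then obtain S where S: "\<And>v. v \<in> B \<Longrightarrow> S v \<subseteq> TT \<and> S v \<noteq> {} \<and> v = Inf (ereal ` S v)"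
    by metis
  have "Inf A = Inf B"
  proof (rule antisym)
    show "Inf A \<le> Inf B" by (auto simp: B_def intro: Inf_superset_mono)
    obtain b where b: "b \<in> B" using \<open>B \<noteq> {}\<close> by blast
    have "b \<le> horizon TT" using b assms(2) by (auto simp: B_def intro: time_values_le_horizon)
    then have "Inf B \<le> horizon TT" using b by (meson Inf_lower order_trans)
    then show "Inf B \<le> Inf A" by (intro Inf_greatest) (metis B_def DiffI Inf_lower singletonD)
  qed
  also have "\<dots> = Inf (ereal ` (\<Union>v\<in>B. S v))"
  proof (rule antisym)
    show "Inf B \<le> Inf (ereal ` (\<Union>v\<in>B. S v))"
    proof (rule Inf_greatest)
      fix x assume "x \<in> ereal ` (\<Union>v\<in>B. S v)"
      then obtain v where v: "v \<in> B" "x \<in> ereal ` S v" by auto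
      then have "v \<le> x" using S[OF v(1)] by (metis Inf_lower)
      then show "Inf B \<le> x" using v(1) by (meson Inf_lower order_trans)
    qed
    show "Inf (ereal ` (\<Union>v\<in>B. S v)) \<le> Inf B"
    proof (rule Inf_greatest)
      fix v assume v: "v \<in> B"
      have "Inf (ereal ` (\<Union>v\<in>B. S v)) \<le> Inf (ereal ` S v)"
        using v by (intro Inf_superset_mono) auto
      then show "Inf (ereal ` (\<Union>v\<in>B. S v)) \<le> v" using S[OF v] by simp
    qed
  qed
  finally have "Inf A = Inf (ereal ` (\<Union>v\<in>B. S v))" .
  moreover have "(\<Union>v\<in>B. S v) \<subseteq> TT" "(\<Union>v\<in>B. S v) \<noteq> {}" using S \<open>B \<noteq> {}\<close> by auto
  ultimately show ?thesis unfolding time_values_def by blast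
qed

text \<open>
  At a time followed by a gap in \<open>TT\<close>, a stopping time jumps over the gap. This replaces right
  continuity at the points where the filtration need not be right continuous.
\<close>

lemma time_values_gap:
  assumes "\<not> t islimpt (TT \<inter> {t<..})"
  obtains u where "t < u" and "\<And>v. v \<in> time_values TT \<Longrightarrow> v \<le> ereal t \<or> ereal u \<le> v"
proof -
  obtain e where e: "e > 0" "\<And>s. s \<in> TT \<Longrightarrow> t < s \<Longrightarrow> t + e \<le> s"
    using assms unfolding islimpt_approachable dist_real_def by force
  have "v \<le> ereal t \<or> ereal (t + e) \<le> v" if v: "v \<in> time_values TT" for v
  proof (cases "v = horizon TT")
    case True
    show ?thesis
    proof (cases "\<exists>s\<in>TT. t < s")
      case True
      then obtain s where "s \<in> TT" "t < s" by blast
      then have "ereal (t + e) \<le> ereal s" "ereal s \<le> horizon TT"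
        using e(2) by (auto simp: horizon_def intro: Sup_upper)
      then show ?thesis using \<open>v = horizon TT\<close> by (metis order_trans)
    next
      case False
      then show ?thesis using \<open>v = horizon TT\<close>
        by (auto simp: horizon_def not_less intro!: Sup_least)
    qed
  next
    case False
    then obtain S where S: "S \<subseteq> TT" "v = Inf (ereal ` S)"
      using v by (auto simp: time_values_def)
    show ?thesis
    proof (cases "\<exists>s\<in>S. s \<le> t")
      case True
      then show ?thesis unfolding S(2) by (meson Inf_lower ereal_less_eq(3) imageI order_trans)
    next
      case False
      then have "ereal (t + e) \<le> v"
        unfolding S(2) using S(1) e(2) by (intro Inf_greatest) (force simp: not_le)
      then show ?thesis ..
    qed
  qed
  with e(1) show ?thesis by (intro that[of "t + e"]) auto
qed

section \<open>Stability of stopping times\<close>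

context preference_setting
begin

lemma space_filtration: "t \<in> TT \<Longrightarrow> space (F t) = space M"
  using filtration_sub by (simp add: subalgebra_def)

lemma pred_filtration_mono:
  assumes "s \<in> TT" "t \<in> TT" "s \<le> t" "Measurable.pred (F s) P"
  shows "Measurable.pred (F t) P"
  using assms filtration_mono[OF assms(1-3)] by (auto simp: pred_def space_filtration)

lemma pred_right_continuous:
  assumes "t \<in> TT" "t islimpt (TT \<inter> {t<..})"
    and "\<And>s. s \<in> TT \<Longrightarrow> t < s \<Longrightarrow> Measurable.pred (F s) P"
  shows "Measurable.pred (F t) P"
proof -
  have "{\<omega> \<in> space M. P \<omega>} \<in> sets (F s)" if "s \<in> TT" "t < s" for s
    using assms(3)[OF that] that by (simp add: pred_def space_filtration)
  then have "{\<omega> \<in> space M. P \<omega>} \<in> sets (F t)"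
    unfolding right_continuous[OF assms(1,2)] by auto
  then show ?thesis using assms(1) by (simp add: pred_def space_filtration)
qed

text \<open>
  If later time points accumulate at \<open>t\<close>, the infimum is at most \<open>t\<close> iff each of countably many
  \<open>g k \<in> TT\<close> decreasing to \<open>t\<close> bounds some member of the sequence; this is known at every time
  after \<open>t\<close>, hence at \<open>t\<close>. If there is a gap after \<open>t\<close>, it is at most \<open>t\<close> iff some member is.
\<close>

lemma is_stopping_time_INF:
  fixes \<tau> :: "nat \<Rightarrow> 'a \<Rightarrow> ereal"
  assumes \<tau>: "\<And>n. is_stopping_time M TT F (\<tau> n)"
  shows "is_stopping_time M TT F (\<lambda>\<omega>. INF n. \<tau> n \<omega>)"
  unfolding is_stopping_time_def
proof (intro conjI ballI)
  have range: "\<tau> n \<omega> \<in> time_values TT" if "\<omega> \<in> space M" for n \<omega>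
    using \<tau>[of n] that by (auto simp: is_stopping_time_def)
  have adapted: "Measurable.pred (F t) (\<lambda>\<omega>. \<tau> n \<omega> \<le> ereal t)" if "t \<in> TT" for n t
    using \<tau>[of n] that by (auto simp: is_stopping_time_def)
  show "(INF n. \<tau> n \<omega>) \<in> time_values TT" if "\<omega> \<in> space M" for \<omega>
    using range[OF that] by (intro time_values_Inf) auto
  fix t assume t: "t \<in> TT"
  show "Measurable.pred (F t) (\<lambda>\<omega>. (INF n. \<tau> n \<omega>) \<le> ereal t)"
  proof (cases "t islimpt (TT \<inter> {t<..})")
    case True
    show ?thesis
    proof (rule pred_right_continuous[OF t True])
      fix s assume s: "s \<in> TT" "t < s"
      obtain f where f: "\<And>k. f k \<in> TT \<inter> {t<..}" "f \<longlonglongrightarrow> t"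
        using True unfolding islimpt_sequential by auto
      \<comment> \<open>capping the sequence at \<open>s\<close> keeps all the events involved in \<open>F s\<close>\<close>
      define g where "g k = min (f k) s" for k
      have g: "g k \<in> TT" "t < g k" "g k \<le> s" for k
        using f(1)[of k] s by (auto simp: g_def min_def)
      have "g \<longlonglongrightarrow> min t s" unfolding g_def by (intro tendsto_min f(2) tendsto_const)
      then have lim: "(\<lambda>k. ereal (g k)) \<longlonglongrightarrow> ereal t" using s(2) by (simp add: min_def)
      have "((INF n. \<tau> n \<omega>) \<le> ereal t) = (\<forall>k. \<exists>n. \<tau> n \<omega> \<le> ereal (g k))" for \<omega>
      proof
        assume le: "(INF n. \<tau> n \<omega>) \<le> ereal t"
        show "\<forall>k. \<exists>n. \<tau> n \<omega> \<le> ereal (g k)"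
        proof
          fix k
          have "(INF n. \<tau> n \<omega>) < ereal (g k)" using le g(2)[of k] by (simp add: le_less_trans)
          then show "\<exists>n. \<tau> n \<omega> \<le> ereal (g k)" by (auto simp: INF_less_iff intro: less_imp_le)
        qed
      next
        assume "\<forall>k. \<exists>n. \<tau> n \<omega> \<le> ereal (g k)"
        then have "(INF n. \<tau> n \<omega>) \<le> ereal (g k)" for k by (meson INF_lower2 UNIV_I)
        then show "(INF n. \<tau> n \<omega>) \<le> ereal t" by (intro LIMSEQ_le_const[OF lim]) auto
      qed
      moreover have "Measurable.pred (F s) (\<lambda>\<omega>. \<tau> n \<omega> \<le> ereal (g k))" for n k
        by (rule pred_filtration_mono[OF g(1) s(1) g(3) adapted[OF g(1)]])
      ultimately show "Measurable.pred (F s) (\<lambda>\<omega>. (INF n. \<tau> n \<omega>) \<le> ereal t)" by simp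
    qed
  next
    case False
    then obtain u where u: "t < u" "\<And>v. v \<in> time_values TT \<Longrightarrow> v \<le> ereal t \<or> ereal u \<le> v"
      by (rule time_values_gap) blast
    have "((INF n. \<tau> n \<omega>) \<le> ereal t) = (\<exists>n. \<tau> n \<omega> \<le> ereal t)" if "\<omega> \<in> space (F t)" for \<omega>
    proof
      assume le: "(INF n. \<tau> n \<omega>) \<le> ereal t"
      then have "(INF n. \<tau> n \<omega>) < ereal u" using u(1) by (simp add: le_less_trans)
      then obtain n where "\<tau> n \<omega> < ereal u" by (auto simp: INF_less_iff)
      then show "\<exists>n. \<tau> n \<omega> \<le> ereal t"
        using u(2)[OF range[of \<omega> n]] that t by (auto simp: space_filtration)
    next
      assume "\<exists>n. \<tau> n \<omega> \<le> ereal t"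
      then show "(INF n. \<tau> n \<omega>) \<le> ereal t" by (meson INF_lower2 UNIV_I)
    qed
    moreover have "Measurable.pred (F t) (\<lambda>\<omega>. \<exists>n. \<tau> n \<omega> \<le> ereal t)"
      using adapted[OF t] by simp
    ultimately show ?thesis by (subst measurable_cong) auto
  qed
qed

lemma is_stopping_time_max_const:
  assumes \<tau>: "is_stopping_time M TT F \<tau>" and t: "t \<in> TT"
  shows "is_stopping_time M TT F (\<lambda>\<omega>. max (\<tau> \<omega>) (ereal t))"
  unfolding is_stopping_time_def
proof (intro conjI ballI)
  show "max (\<tau> \<omega>) (ereal t) \<in> time_values TT" if "\<omega> \<in> space M" for \<omega>
    using \<tau> that time_values_const[OF t] by (auto simp: is_stopping_time_def max_def)
  show "Measurable.pred (F s) (\<lambda>\<omega>. max (\<tau> \<omega>) (ereal t) \<le> ereal s)" if "s \<in> TT" for s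
    using \<tau> that by (cases "t \<le> s") (auto simp: is_stopping_time_def)
qed

end

section \<open>Naive times and their limit\<close>

lemma naive_time_decseq: "decseq (\<lambda>n. naive_time M TT F J n \<omega>)"
  by (intro decseq_SucI) (simp add: naive_map_def)

lemma naive_time_tendsto_limit: "(\<lambda>n. naive_time M TT F J n \<omega>) \<longlonglongrightarrow> naive_limit M TT F J \<omega>"
  using LIMSEQ_INF[OF naive_time_decseq[of M TT F J \<omega>]]
  by (simp add: naive_limit_def limI)

lemma naive_limit_le: "naive_limit M TT F J \<omega> \<le> naive_time M TT F J n \<omega>"
  by (rule decseq_ge[OF naive_time_decseq naive_time_tendsto_limit])

text \<open>
  Times interlaced with the naive times inherit their monotone convergence; \<open>c\<close> will be the
  time at which the preference is evaluated.
\<close>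

lemma interlaced_with_naive_times:
  fixes r :: "nat \<Rightarrow> ereal"
  assumes lo: "\<And>n. max (naive_time M TT F J (Suc n) \<omega>) c \<le> r n"
    and hi: "\<And>n. r n \<le> max (naive_time M TT F J n \<omega>) c"
  shows "decseq r" and "r \<longlonglongrightarrow> max (naive_limit M TT F J \<omega>) c"
proof -
  show "decseq r" using lo hi by (intro decseq_SucI) (meson order_trans)
  note lim = naive_time_tendsto_limit[of M TT F J \<omega>]
  show "r \<longlonglongrightarrow> max (naive_limit M TT F J \<omega>) c"
    by (rule tendsto_sandwich[OF _ _ tendsto_max[OF LIMSEQ_Suc[OF lim] tendsto_const]
              tendsto_max[OF lim tendsto_const]])
       (use lo hi in auto)
qed

theorem theorem3p5:
  fixes M :: "'a measure"
    and TT :: "real set"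
    and F :: "real \<Rightarrow> 'a measure"
    and J :: "('a \<Rightarrow> ereal) \<Rightarrow> real \<Rightarrow> 'a \<Rightarrow> real"
  assumes "preference_setting M TT F J"
    and "right_semicontinuous M TT F J"
    and "\<And>n. n \<ge> 1 \<Longrightarrow>
           worth_continuing M TT F J (naive_time M TT F J n) (naive_time M TT F J (n - 1))"
  shows "approachable M TT F J (naive_limit M TT F J)"
proof -
  interpret preference_setting M TT F J by (fact assms(1))
  let ?\<rho> = "naive_time M TT F J" and ?\<rho>_lim = "naive_limit M TT F J"
  have "\<forall>n. worth_continuing M TT F J (?\<rho> (Suc n)) (?\<rho> n)"
    using assms(3)[of "Suc _"] by simp
  from choice[OF this[unfolded worth_continuing_def]]
  obtain r where r_all: "\<forall>n.
      (\<forall>t\<in>TT. r n t \<in> stopping_times_from M TT F (const_time t) \<and>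
         (AE \<omega> in M. max (?\<rho> (Suc n) \<omega>) (ereal t) \<le> r n t \<omega> \<and>
                     r n t \<omega> \<le> max (?\<rho> n \<omega>) (ereal t))) \<and>
      (AE \<omega> in M. \<forall>t\<in>TT. ereal t < ?\<rho> (Suc n) \<omega> \<longrightarrow>
         J (const_time t) t \<omega> \<le> J (r n t) t \<omega>)" ..
  have r: "r n t \<in> stopping_times_from M TT F (const_time t)"
    and interlaced: "AE \<omega> in M. max (?\<rho> (Suc n) \<omega>) (ereal t) \<le> r n t \<omega> \<and>
          r n t \<omega> \<le> max (?\<rho> n \<omega>) (ereal t)" if "t \<in> TT" for n t
    using r_all that by (simp_all del: naive_time.simps)
  have better: "AE \<omega> in M. \<forall>t\<in>TT. ereal t < ?\<rho> (Suc n) \<omega> \<longrightarrow>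
      J (const_time t) t \<omega> \<le> J (r n t) t \<omega>" for n
    using r_all by (simp del: naive_time.simps)
  have r_lim: "AE \<omega> in M. decseq (\<lambda>n. r n t \<omega>) \<and> (\<lambda>n. r n t \<omega>) \<longlonglongrightarrow> max (?\<rho>_lim \<omega>) (ereal t)"
    if "t \<in> TT" for t
  proof -
    have "AE \<omega> in M. \<forall>n. max (?\<rho> (Suc n) \<omega>) (ereal t) \<le> r n t \<omega> \<and>
        r n t \<omega> \<le> max (?\<rho> n \<omega>) (ereal t)"
      using interlaced[OF that] by (simp add: AE_all_countable del: naive_time.simps)
    then show ?thesis
    proof eventually_elim
      case (elim \<omega>)
      then show ?case
        by (intro conjI interlaced_with_naive_times[of M TT F J]) blast+
    qed
  qed

  define \<sigma> where "\<sigma> \<omega> = (INF n. r n 0 \<omega>)" for \<omega>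
  have \<sigma>_stop: "is_stopping_time M TT F \<sigma>"
    unfolding \<sigma>_def using r[OF zero_time]
    by (intro is_stopping_time_INF) (auto simp: stopping_times_from_def)
  have horizon_nonneg: "0 \<le> horizon TT"
    using zero_time by (auto simp: horizon_def zero_ereal_def intro: Sup_upper)
  have naive_nonneg: "0 \<le> ?\<rho> n \<omega>" for n \<omega>
  proof (induction n arbitrary: \<omega>)
    case (Suc n)
    then show ?case
      using times_nonneg by (auto simp: naive_map_def intro!: Inf_greatest)
  qed (simp add: horizon_nonneg)
  then have limit_nonneg: "0 \<le> ?\<rho>_lim \<omega>" for \<omega>
    by (intro LIMSEQ_le_const[OF naive_time_tendsto_limit]) auto
  have \<sigma>_eq: "AE \<omega> in M. ?\<rho>_lim \<omega> = \<sigma> \<omega>"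
    using r_lim[OF zero_time]
  proof eventually_elim
    case (elim \<omega>)
    have "(INF n. r n 0 \<omega>) = max (?\<rho>_lim \<omega>) (ereal 0)"
      using elim by (metis LIMSEQ_INF LIMSEQ_unique)
    then show ?case using limit_nonneg[of \<omega>] by (simp add: \<sigma>_def max_absorb1 flip: zero_ereal_def)
  qed

  let ?\<sigma> = "\<lambda>t \<omega>. max (\<sigma> \<omega>) (ereal t)"
  have \<sigma>_from: "?\<sigma> t \<in> stopping_times_from M TT F (const_time t)" if "t \<in> TT" for t
    using is_stopping_time_max_const[OF \<sigma>_stop that] by (simp add: stopping_times_from_def)
  have "AE \<omega> in M. decseq (\<lambda>n. r n t \<omega>) \<and> (\<lambda>n. r n t \<omega>) \<longlonglongrightarrow> ?\<sigma> t \<omega>" if "t \<in> TT" for t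
    using r_lim[OF that] \<sigma>_eq by eventually_elim simp
  with r \<sigma>_from have semicont: "AE \<omega> in M. \<forall>t\<in>TT.
      limsup (\<lambda>n. ereal (J (r n t) t \<omega>)) \<le> ereal (J (?\<sigma> t) t \<omega>)"
    using assms(2)[unfolded right_semicontinuous_def, rule_format, of "\<lambda>t n. r n t" ?\<sigma>]
    by blast
  have better_all: "AE \<omega> in M. \<forall>n. \<forall>t\<in>TT. ereal t < ?\<rho> (Suc n) \<omega> \<longrightarrow>
      J (const_time t) t \<omega> \<le> J (r n t) t \<omega>"
    using better by (simp add: AE_all_countable del: naive_time.simps)
  have fixed: "AE \<omega> in M. naive_map M TT F J ?\<rho>_lim \<omega> = ?\<rho>_lim \<omega>"
    using better_all semicont \<sigma>_eq
  proof eventually_elim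
    case (elim \<omega>)
    have beaten: "\<exists>\<tau>\<in>stopping_times_from M TT F (const_time t).
        ((AE \<omega>' in M. \<tau> \<omega>' \<le> max (?\<rho>_lim \<omega>') (ereal t)) \<and> ereal t < \<tau> \<omega>) \<and>
        \<not> J \<tau> t \<omega> < J (const_time t) t \<omega>"
      if t: "t \<in> TT" and less: "ereal t < ?\<rho>_lim \<omega>" for t
    proof (intro bexI[OF _ \<sigma>_from[OF t]] conjI)
      show "AE \<omega>' in M. ?\<sigma> t \<omega>' \<le> max (?\<rho>_lim \<omega>') (ereal t)"
        using \<sigma>_eq by eventually_elim simp
      show "ereal t < ?\<sigma> t \<omega>" using elim(3) less by simp
      have "ereal (J (const_time t) t \<omega>) \<le> ereal (J (r n t) t \<omega>)" for n
        using elim(1) t less_le_trans[OF less naive_limit_le] by (simp del: naive_time.simps)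
      then have "ereal (J (const_time t) t \<omega>) \<le> limsup (\<lambda>n. ereal (J (r n t) t \<omega>))"
        by (intro Limsup_bounded le_Limsup) auto
      also have "\<dots> \<le> ereal (J (?\<sigma> t) t \<omega>)" using elim(2) t by blast
      finally show "\<not> J (?\<sigma> t) t \<omega> < J (const_time t) t \<omega>" by simp
    qed
    then have empty: "{t\<in>TT. ereal t < ?\<rho>_lim \<omega> \<and>
        (\<forall>\<tau>\<in>stopping_times_from M TT F (const_time t).
           (AE \<omega>' in M. \<tau> \<omega>' \<le> max (?\<rho>_lim \<omega>') (ereal t)) \<and> ereal t < \<tau> \<omega> \<longrightarrow>
           J (const_time t) t \<omega> > J \<tau> t \<omega>)} = {}"
      by blast
    show ?case unfolding naive_map_def empty by (simp add: top_ereal_def)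
  qed
  have "AE \<omega> in M. ereal 0 \<le> \<sigma> \<omega>"
    using \<sigma>_eq
  proof eventually_elim
    case (elim \<omega>)
    then show ?case using limit_nonneg[of \<omega>] by (simp flip: zero_ereal_def)
  qed
  then have "\<sigma> \<in> stopping_times_from M TT F (const_time 0)"
    using \<sigma>_stop by (simp add: stopping_times_from_def)
  then show ?thesis unfolding approachable_def using \<sigma>_eq fixed by blast
qed

end
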